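(* Let $\Phi = (A; \{E_i\}_{i=0}^d; A^*; \{E^*_i\}_{i=0}^d)$ be a self-dual Leonard system on $V$. Define the following elements of $\mathrm{End}(V)$: $$T = \sum_{i=0}^d \eta_{d-i}(A) E^*_0 E_d \tau^*_i(A^* ), \qquad T^* = \sum_{i=0}^d \eta^*_{d-i}(A^* ) E_0 E^*_d \tau_i(A),$$ $$T^\dagger = \sum_{i=0}^d \tau^*_i(A^* ) E_d E^*_0 \eta_{d-i}(A), \qquad (T^* )^\dagger = \sum_{i=0}^d \tau_i(A) E^*_d E_0 \eta^*_{d-i}(A^* ).$$ Then the elements $T$, $T^*$, $T^\dagger$, $(T^* )^\dagger$ are equal, and this common element gives the duality $\Phi \leftrightarrow \Phi^*$; that is, $T$ is invertible and the duality $\Phi\leftrightarrow\Phi^*$ is the map $X \mapsto T X T^{-1}$ on $\mathrm{End}(V)$.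
   Context: Let $\mathbb{F}$ be a field and $V$ a vector space over $\mathbb{F}$ with finite positive dimension; $\mathrm{End}(V)$ is the $\mathbb{F}$-algebra of $\mathbb{F}$-linear maps $V\to V$. A square matrix is tridiagonal if each nonzero entry lies on the diagonal, subdiagonal or superdiagonal; a tridiagonal matrix is irreducible if every subdiagonal entry and every superdiagonal entry is nonzero. A Leonard pair on $V$ is an ordered pair $A, A^*$ of elements of $\mathrm{End}(V)$ (the symbol $A^*$ does not denote an adjoint) such that (i) there is a basis of $V$ with respect to which $A$ is represented by an irreducible tridiagonal matrix and $A^*$ by a diagonal matrix; (ii) there is a basis of $V$ with respect to which $A^*$ is represented by an irreducible tridiagonal matrix and $A$ by a diagonal matrix. For a Leonard pair each of $A$, $A^*$ is multiplicity-free (diagonalizable with all eigenspaces of dimension one). For a multiplicity-free element, its primitive idempotents are the projections onto its eigenspaces (identity on one eigenspace, zero on the others). An ordering $\{E_i\}_{i=0}^d$ of the primitive idempotents of $A$ is standard if, for $0\neq v_i\in E_iV$, the matrix representing $A^*$ with respect to the basis $\{v_i\}_{i=0}^d$ is irreducible tridiagonal; a standard ordering of the primitive idempotents of $A^*$ is defined similarly with the roles of $A,A^*$ swapped. A Leonard system on $V$ is a sequence $\Phi=(A;\{E_i\}_{i=0}^d;A^*;\{E_i^*\}_{i=0}^d)$ where $A,A^*$ is a Leonard pair on $V$ and $\{E_i\}_{i=0}^d$, $\{E^*_i\}_{i=0}^d$ are standard orderings of the primitive idempotents of $A$, $A^*$ respectively (so $\dim V=d+1$). Let $\theta_i$ (resp.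 $\theta^*_i$) be the eigenvalue of $A$ (resp. $A^*$) corresponding to $E_i$ (resp. $E_i^*$). Let $\Phi^*=(A^*;\{E_i^*\}_{i=0}^d;A;\{E_i\}_{i=0}^d)$, again a Leonard system. $\Phi$ is self-dual if there is an $\mathbb{F}$-algebra automorphism $\sigma$ of $\mathrm{End}(V)$ sending $A\mapsto A^*$, $A^*\mapsto A$, $E_i\mapsto E^*_i$, $E_i^*\mapsto E_i$ $(0\le i\le d)$; such $\sigma$ is unique and is called the duality $\Phi\leftrightarrow\Phi^*$. An invertible $K\in\mathrm{End}(V)$ gives an automorphism $\sigma$ of $\mathrm{End}(V)$ if $X^\sigma=KXK^{-1}$ for all $X\in\mathrm{End}(V)$. For $0\le i\le d$ define polynomials $\tau_i=(x-\theta_0)(x-\theta_1)\cdots(x-\theta_{i-1})$, $\eta_i=(x-\theta_d)(x-\theta_{d-1})\cdots(x-\theta_{d-i+1})$, $\tau_i^*=(x-\theta^*_0)\cdots(x-\theta^*_{i-1})$, $\eta_i^*=(x-\theta^*_d)\cdots(x-\theta^*_{d-i+1})$ (empty products are $1$). Here $\dagger$ is the unique antiautomorphism of $\mathrm{End}(V)$ that fixes each of $A$, $A^*$ (it fixes every polynomial in $A$ and every polynomial in $A^*$), and $T^*$ is the element obtained from the definition of $T$ by replacing $\Phi$ with $\Phi^*$. *)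

theory Defs
  imports Complex_Main "HOL-Computational_Algebra.Polynomial"
begin

text \<open>The space V is the carrier type of a vector space over an arbitrary field, given by its
  scalar multiplication \<open>scale\<close>. Endomorphisms are functions in \<open>endos\<close>,
  multiplied by composition. Indexed families are functions on \<open>nat\<close>; only the indices
  \<open>0, \<dots>, d\<close> matter.\<close>

definition tridiagonal :: "nat \<Rightarrow> (nat \<Rightarrow> nat \<Rightarrow> 'c::zero) \<Rightarrow> bool" where
  "tridiagonal d M \<longleftrightarrow>
     (\<forall>i\<le>d. \<forall>j\<le>d. M i j \<noteq> 0 \<longrightarrow> i = j \<or> i = Suc j \<or> j = Suc i)"

definition irreducible_tridiagonal :: "nat \<Rightarrow> (nat \<Rightarrow> nat \<Rightarrow> 'c::zero) \<Rightarrow> bool" where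
  "irreducible_tridiagonal d M \<longleftrightarrow>
     tridiagonal d M \<and> (\<forall>i<d. M (Suc i) i \<noteq> 0 \<and> M i (Suc i) \<noteq> 0)"

definition diagonal :: "nat \<Rightarrow> (nat \<Rightarrow> nat \<Rightarrow> 'c::zero) \<Rightarrow> bool" where
  "diagonal d M \<longleftrightarrow> (\<forall>i\<le>d. \<forall>j\<le>d. M i j \<noteq> 0 \<longrightarrow> i = j)"

definition tau_poly :: "(nat \<Rightarrow> 'c::field) \<Rightarrow> nat \<Rightarrow> 'c poly" where
  "tau_poly \<theta> i = (\<Prod>h<i. [:- \<theta> h, 1:])"

definition eta_poly :: "nat \<Rightarrow> (nat \<Rightarrow> 'c::field) \<Rightarrow> nat \<Rightarrow> 'c poly" where
  "eta_poly d \<theta> i = (\<Prod>h<i. [:- \<theta> (d - h), 1:])"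

locale endomorphism_algebra = vector_space scale
  for scale :: "'a::field \<Rightarrow> 'b::ab_group_add \<Rightarrow> 'b"  (infixr "*s" 75)
begin

definition endos :: "('b \<Rightarrow> 'b) set" where
  "endos = {X. Vector_Spaces.linear scale scale X}"

definition ordered_basis :: "nat \<Rightarrow> (nat \<Rightarrow> 'b) \<Rightarrow> bool" where
  "ordered_basis d v \<longleftrightarrow>
     inj_on v {..d} \<and> independent (v ` {..d}) \<and> span (v ` {..d}) = UNIV"

definition represents :: "nat \<Rightarrow> (nat \<Rightarrow> 'b) \<Rightarrow> ('b \<Rightarrow> 'b) \<Rightarrow> (nat \<Rightarrow> nat \<Rightarrow> 'a) \<Rightarrow> bool" where
  "represents d v X M \<longleftrightarrow>
     ordered_basis d v \<and> (\<forall>j\<le>d. X (v j) = (\<Sum>i\<le>d. M i j *s v i))"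

definition leonard_pair :: "('b \<Rightarrow> 'b) \<Rightarrow> ('b \<Rightarrow> 'b) \<Rightarrow> bool" where
  "leonard_pair A As \<longleftrightarrow> A \<in> endos \<and> As \<in> endos \<and>
     (\<exists>d v M N. represents d v A M \<and> irreducible_tridiagonal d M \<and>
                represents d v As N \<and> diagonal d N) \<and>
     (\<exists>d v M N. represents d v As M \<and> irreducible_tridiagonal d M \<and>
                represents d v A N \<and> diagonal d N)"

definition eigenspace :: "('b \<Rightarrow> 'b) \<Rightarrow> 'a \<Rightarrow> 'b set" where
  "eigenspace A t = {v. A v = t *s v}"

definition eigenvalue :: "('b \<Rightarrow> 'b) \<Rightarrow> 'a \<Rightarrow> bool" where
  "eigenvalue A t \<longleftrightarrow> (\<exists>v\<in>eigenspace A t. v \<noteq> 0)"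

text \<open>When \<open>A\<close> is diagonalizable, the following determines \<open>P\<close> from
  \<open>t\<close>, and \<open>t\<close> from \<open>P\<close>.\<close>

definition primitive_idempotent_for :: "('b \<Rightarrow> 'b) \<Rightarrow> 'a \<Rightarrow> ('b \<Rightarrow> 'b) \<Rightarrow> bool" where
  "primitive_idempotent_for A t P \<longleftrightarrow> P \<in> endos \<and> eigenvalue A t \<and>
     (\<forall>v\<in>eigenspace A t. P v = v) \<and>
     (\<forall>u. u \<noteq> t \<longrightarrow> (\<forall>v\<in>eigenspace A u. P v = 0))"

definition primitive_idempotents :: "('b \<Rightarrow> 'b) \<Rightarrow> ('b \<Rightarrow> 'b) set" where
  "primitive_idempotents A = {P. \<exists>t. primitive_idempotent_for A t P}"

definition eigenvalue_of :: "('b \<Rightarrow> 'b) \<Rightarrow> ('b \<Rightarrow> 'b) \<Rightarrow> 'a" where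
  "eigenvalue_of A P = (THE t. primitive_idempotent_for A t P)"

definition standard_ordering ::
  "nat \<Rightarrow> ('b \<Rightarrow> 'b) \<Rightarrow> ('b \<Rightarrow> 'b) \<Rightarrow> (nat \<Rightarrow> 'b \<Rightarrow> 'b) \<Rightarrow> bool" where
  "standard_ordering d A As E \<longleftrightarrow>
     bij_betw E {..d} (primitive_idempotents A) \<and>
     (\<forall>v. (\<forall>i\<le>d. v i \<in> range (E i) \<and> v i \<noteq> 0) \<longrightarrow>
          (\<exists>M. represents d v As M \<and> irreducible_tridiagonal d M))"

definition leonard_system ::
  "nat \<Rightarrow> ('b \<Rightarrow> 'b) \<Rightarrow> (nat \<Rightarrow> 'b \<Rightarrow> 'b) \<Rightarrow> ('b \<Rightarrow> 'b) \<Rightarrow> (nat \<Rightarrow> 'b \<Rightarrow> 'b) \<Rightarrow> bool" where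
  "leonard_system d A E As Es \<longleftrightarrow>
     leonard_pair A As \<and> standard_ordering d A As E \<and> standard_ordering d As A Es"

text \<open>Maps on \<open>endos\<close> are total functions whose values outside \<open>endos\<close> are
  irrelevant, so two such maps should only be compared on \<open>endos\<close>.\<close>

definition linear_bijection :: "(('b \<Rightarrow> 'b) \<Rightarrow> ('b \<Rightarrow> 'b)) \<Rightarrow> bool" where
  "linear_bijection \<sigma> \<longleftrightarrow> bij_betw \<sigma> endos endos \<and>
     (\<forall>X\<in>endos. \<forall>Y\<in>endos. \<sigma> (\<lambda>v. X v + Y v) = (\<lambda>v. \<sigma> X v + \<sigma> Y v)) \<and>
     (\<forall>c. \<forall>X\<in>endos. \<sigma> (\<lambda>v. c *s X v) = (\<lambda>v. c *s \<sigma> X v))"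

definition algebra_automorphism :: "(('b \<Rightarrow> 'b) \<Rightarrow> ('b \<Rightarrow> 'b)) \<Rightarrow> bool" where
  "algebra_automorphism \<sigma> \<longleftrightarrow> linear_bijection \<sigma> \<and> \<sigma> id = id \<and>
     (\<forall>X\<in>endos. \<forall>Y\<in>endos. \<sigma> (X \<circ> Y) = \<sigma> X \<circ> \<sigma> Y)"

definition algebra_antiautomorphism :: "(('b \<Rightarrow> 'b) \<Rightarrow> ('b \<Rightarrow> 'b)) \<Rightarrow> bool" where
  "algebra_antiautomorphism \<sigma> \<longleftrightarrow> linear_bijection \<sigma> \<and> \<sigma> id = id \<and>
     (\<forall>X\<in>endos. \<forall>Y\<in>endos. \<sigma> (X \<circ> Y) = \<sigma> Y \<circ> \<sigma> X)"

definition duality ::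
  "nat \<Rightarrow> ('b \<Rightarrow> 'b) \<Rightarrow> (nat \<Rightarrow> 'b \<Rightarrow> 'b) \<Rightarrow> ('b \<Rightarrow> 'b) \<Rightarrow> (nat \<Rightarrow> 'b \<Rightarrow> 'b) \<Rightarrow>
   (('b \<Rightarrow> 'b) \<Rightarrow> ('b \<Rightarrow> 'b)) \<Rightarrow> bool" where
  "duality d A E As Es \<sigma> \<longleftrightarrow> algebra_automorphism \<sigma> \<and> \<sigma> A = As \<and> \<sigma> As = A \<and>
     (\<forall>i\<le>d. \<sigma> (E i) = Es i \<and> \<sigma> (Es i) = E i)"

definition self_dual ::
  "nat \<Rightarrow> ('b \<Rightarrow> 'b) \<Rightarrow> (nat \<Rightarrow> 'b \<Rightarrow> 'b) \<Rightarrow> ('b \<Rightarrow> 'b) \<Rightarrow> (nat \<Rightarrow> 'b \<Rightarrow> 'b) \<Rightarrow> bool" where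
  "self_dual d A E As Es \<longleftrightarrow> (\<exists>\<sigma>. duality d A E As Es \<sigma>)"

definition gives :: "('b \<Rightarrow> 'b) \<Rightarrow> (('b \<Rightarrow> 'b) \<Rightarrow> ('b \<Rightarrow> 'b)) \<Rightarrow> bool" where
  "gives K \<sigma> \<longleftrightarrow> K \<in> endos \<and> bij K \<and> (\<forall>X\<in>endos. \<sigma> X = K \<circ> X \<circ> inv K)"

definition poly_endo :: "'a poly \<Rightarrow> ('b \<Rightarrow> 'b) \<Rightarrow> 'b \<Rightarrow> 'b" where
  "poly_endo p X = (\<lambda>v. \<Sum>k\<le>degree p. coeff p k *s (X ^^ k) v)"

definition tau ::
  "('b \<Rightarrow> 'b) \<Rightarrow> (nat \<Rightarrow> 'b \<Rightarrow> 'b) \<Rightarrow> nat \<Rightarrow> 'a poly" where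
  "tau A E i = tau_poly (\<lambda>h. eigenvalue_of A (E h)) i"

definition eta ::
  "nat \<Rightarrow> ('b \<Rightarrow> 'b) \<Rightarrow> (nat \<Rightarrow> 'b \<Rightarrow> 'b) \<Rightarrow> nat \<Rightarrow> 'a poly" where
  "eta d A E i = eta_poly d (\<lambda>h. eigenvalue_of A (E h)) i"

text \<open>\<open>T\<^sup>*\<close> and its image under the antiautomorphism are obtained from the next two
  definitions by exchanging \<open>(A, E)\<close> and \<open>(As, Es)\<close>.\<close>

definition T_elt ::
  "nat \<Rightarrow> ('b \<Rightarrow> 'b) \<Rightarrow> (nat \<Rightarrow> 'b \<Rightarrow> 'b) \<Rightarrow> ('b \<Rightarrow> 'b) \<Rightarrow> (nat \<Rightarrow> 'b \<Rightarrow> 'b) \<Rightarrow> 'b \<Rightarrow> 'b" where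
  "T_elt d A E As Es = (\<lambda>v. \<Sum>i\<le>d.
     (poly_endo (eta d A E (d - i)) A \<circ> Es 0 \<circ> E d \<circ> poly_endo (tau As Es i) As) v)"

definition T_dagger ::
  "nat \<Rightarrow> ('b \<Rightarrow> 'b) \<Rightarrow> (nat \<Rightarrow> 'b \<Rightarrow> 'b) \<Rightarrow> ('b \<Rightarrow> 'b) \<Rightarrow> (nat \<Rightarrow> 'b \<Rightarrow> 'b) \<Rightarrow> 'b \<Rightarrow> 'b" where
  "T_dagger d A E As Es = (\<lambda>v. \<Sum>i\<le>d.
     (poly_endo (tau As Es i) As \<circ> E d \<circ> Es 0 \<circ> poly_endo (eta d A E (d - i)) A) v)"

end

end

theory Submission
  imports Defs
begin

text \<open>Write \<open>\<sigma>\<close> for a duality. Every automorphism of \<open>End(V)\<close> is inner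
  (\<open>automorphism_inner\<close>), so \<open>\<sigma> X = K X K\<^sup>-\<^sup>1\<close> for some \<open>K\<close>, and the
  point is to show that \<open>T\<close> is a nonzero multiple of \<open>K\<close>.

  The sum defining \<open>T\<close> telescopes to give \<open>A T = T As\<close> (\<open>A_T\<close>), and
  \<open>A K = K As\<close> as well. This alone leaves one free scalar for each eigenvalue. All of
  them are pinned down by the row of \<open>Es d\<close>: there only the summand with the polynomial
  \<open>\<eta>\<close> of full degree survives, because \<open>A\<close> is tridiagonal in the eigenbasis of
  \<open>As\<close>, and that polynomial is a multiple of \<open>E 0\<close>. Hence
  \<open>Es d T = c Es d E 0 Es 0 E d\<close> with \<open>c \<noteq> 0\<close> (\<open>T_corner\<close>). Like
  \<open>Es d K = K E d\<close>, this has rank one, kernel the kernel of \<open>E d\<close>, and image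
  \<open>Es d V\<close>, so the two are proportional. It is nonzero because an eigenvector of an irreducible
  tridiagonal matrix has nonzero first and last entries (\<open>E0_eigenvector_zero\<close>). The same
  fact shows that a map intertwining \<open>As\<close> with \<open>A\<close> is determined by its
  \<open>Es d\<close> row, and \<open>T = \<kappa> K\<close> follows (\<open>T_multiple\<close>). In particular
  \<open>T\<close> gives every duality.

  The remaining equalities are consequences. Since \<open>\<sigma>\<close> is conjugation by \<open>T\<close>,
  it fixes \<open>T\<close>. It also sends each formula to the one with the roles of \<open>A\<close> and
  \<open>As\<close> exchanged, so \<open>T\<close> agrees with its starred version. The dagger version is the
  element \<open>T\<close> of another self-dual system, obtained by exchanging the operators and
  reversing both orderings (\<open>T_dagger_reverse\<close>), and \<open>\<sigma>\<close> is a duality of that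
  system too. Hence it is a multiple of \<open>T\<close>, and comparing the entries at \<open>Es 0\<close>
  shows that the factor is \<open>1\<close> (\<open>Td_eq_T\<close>).\<close>

section \<open>Endomorphisms and linear maps of the endomorphism algebra\<close>

context endomorphism_algebra
begin

lemma endosI:
  assumes "\<And>x y. X (x + y) = X x + X y" "\<And>c x. X (c *s x) = c *s X x"
  shows "X \<in> endos"
  using assms vector_space_axioms by (simp add: endos_def Vector_Spaces.linear_iff)

lemma endo_add: "X \<in> endos \<Longrightarrow> X (x + y) = X x + X y"
  and endo_scale: "X \<in> endos \<Longrightarrow> X (c *s x) = c *s X x"
  by (simp_all add: endos_def Vector_Spaces.linear_iff)

lemma endo_zero: "X \<in> endos \<Longrightarrow> X 0 = 0"
  using endo_scale[of X 0 0] by simp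

lemma endo_diff: "X \<in> endos \<Longrightarrow> X (x - y) = X x - X y"
  using endo_add[of X "x - y" y] by simp

lemma endo_sum: "X \<in> endos \<Longrightarrow> X (\<Sum>i\<in>I. f i) = (\<Sum>i\<in>I. X (f i))"
  by (induction I rule: infinite_finite_induct) (simp_all add: endo_zero endo_add)

lemmas endo_simps = endo_add endo_scale endo_zero endo_diff endo_sum

lemma ordered_basis_eqI:
  assumes "ordered_basis d v" and X: "X \<in> endos" and Y: "Y \<in> endos"
    and eq: "\<And>i. i \<le> d \<Longrightarrow> X (v i) = Y (v i)"
  shows "X = Y"
proof
  fix u
  have "u \<in> span (v ` {..d})" using assms(1) by (simp add: ordered_basis_def)
  then show "X u = Y u"
    by (induction rule: span_induct_alt) (auto simp: endo_simps X Y eq)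
qed

lemma endos_id: "id \<in> endos"
  by (rule endosI) simp_all

lemma endos_zero: "(\<lambda>_. 0) \<in> endos"
  by (rule endosI) simp_all

lemma endos_comp: "X \<in> endos \<Longrightarrow> Y \<in> endos \<Longrightarrow> X \<circ> Y \<in> endos"
  by (rule endosI) (simp_all add: endo_simps)

lemma endos_add: "X \<in> endos \<Longrightarrow> Y \<in> endos \<Longrightarrow> (\<lambda>u. X u + Y u) \<in> endos"
  by (rule endosI) (simp_all add: endo_simps algebra_simps)

lemma endos_scale: "X \<in> endos \<Longrightarrow> (\<lambda>u. c *s X u) \<in> endos"
  by (rule endosI) (simp_all add: endo_simps scale_right_distrib mult.commute)

lemma endos_sum: "(\<And>i. i \<in> I \<Longrightarrow> X i \<in> endos) \<Longrightarrow> (\<lambda>u. \<Sum>i\<in>I. X i u) \<in> endos"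
  by (induction I rule: infinite_finite_induct) (simp_all add: endos_zero endos_add)

lemma endos_funpow: "X \<in> endos \<Longrightarrow> X ^^ k \<in> endos"
  by (induction k) (simp_all add: endos_id endos_comp del: o_apply)

lemma endos_poly: "X \<in> endos \<Longrightarrow> poly_endo p X \<in> endos"
  unfolding poly_endo_def by (intro endos_sum endos_scale endos_funpow)

lemmas endos_intros = endos_comp endos_scale endos_sum endos_poly

lemma linear_bijection_closed: "linear_bijection \<sigma> \<Longrightarrow> X \<in> endos \<Longrightarrow> \<sigma> X \<in> endos"
  unfolding linear_bijection_def by (blast dest: bij_betwE)

lemma linear_bijection_scale:
  "linear_bijection \<sigma> \<Longrightarrow> X \<in> endos \<Longrightarrow> \<sigma> (\<lambda>u. c *s X u) = (\<lambda>u. c *s \<sigma> X u)"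
  unfolding linear_bijection_def by blast

lemma linear_bijection_add:
  "linear_bijection \<sigma> \<Longrightarrow> X \<in> endos \<Longrightarrow> Y \<in> endos
     \<Longrightarrow> \<sigma> (\<lambda>u. X u + Y u) = (\<lambda>u. \<sigma> X u + \<sigma> Y u)"
  unfolding linear_bijection_def by blast

lemma linear_bijection_zero: "linear_bijection \<sigma> \<Longrightarrow> \<sigma> (\<lambda>_. 0) = (\<lambda>_. 0)"
  using linear_bijection_scale[of \<sigma> "\<lambda>_. 0" 0] by (simp add: endos_zero)

lemma linear_bijection_sum:
  assumes \<sigma>: "linear_bijection \<sigma>"
  shows "(\<And>i. i \<in> I \<Longrightarrow> X i \<in> endos) \<Longrightarrow> \<sigma> (\<lambda>u. \<Sum>i\<in>I. X i u) = (\<lambda>u. \<Sum>i\<in>I. \<sigma> (X i) u)"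
proof (induction I rule: infinite_finite_induct)
  case (insert i I)
  then show ?case
    using linear_bijection_add[OF \<sigma>, of "X i" "\<lambda>u. \<Sum>j\<in>I. X j u"] by (simp add: endos_sum)
qed (simp_all add: linear_bijection_zero[OF \<sigma>])

lemma automorphism_poly:
  assumes "algebra_automorphism \<sigma>" "X \<in> endos"
  shows "\<sigma> (poly_endo p X) = poly_endo p (\<sigma> X)"
proof -
  have lin: "linear_bijection \<sigma>" and one: "\<sigma> id = id"
    and comp: "\<And>Y. Y \<in> endos \<Longrightarrow> \<sigma> (X \<circ> Y) = \<sigma> X \<circ> \<sigma> Y"
    using assms by (auto simp: algebra_automorphism_def)
  have pow: "\<sigma> (X ^^ k) = \<sigma> X ^^ k" for k
    by (induction k) (simp_all add: one comp endos_funpow assms flip: id_def del: o_apply)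
  show ?thesis
    unfolding poly_endo_def
    by (simp add: linear_bijection_sum[OF lin] linear_bijection_scale[OF lin]
        endos_scale endos_funpow assms pow)
qed

lemma antiautomorphism_poly:
  assumes "algebra_antiautomorphism \<sigma>" "X \<in> endos" "\<sigma> X = X"
  shows "\<sigma> (poly_endo p X) = poly_endo p X"
proof -
  have lin: "linear_bijection \<sigma>" and one: "\<sigma> id = id"
    and comp: "\<And>Y. Y \<in> endos \<Longrightarrow> \<sigma> (X \<circ> Y) = \<sigma> Y \<circ> X"
    using assms by (auto simp: algebra_antiautomorphism_def)
  have pow: "\<sigma> (X ^^ k) = X ^^ k" for k
  proof (induction k)
    case (Suc k)
    then have "\<sigma> (X ^^ Suc k) = X ^^ k \<circ> X"
      using comp[of "X ^^ k"] by (simp add: endos_funpow assms(2))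
    then show ?case by (simp only: funpow_Suc_right)
  qed (simp add: one flip: id_def)
  show ?thesis
    unfolding poly_endo_def
    by (simp add: linear_bijection_sum[OF lin] linear_bijection_scale[OF lin]
        endos_scale endos_funpow assms pow)
qed

lemma givesI:
  assumes K: "K \<in> endos" "bij K" and tw: "\<And>X u. X \<in> endos \<Longrightarrow> K (X u) = \<sigma> X (K u)"
  shows "gives K \<sigma>"
  unfolding gives_def
proof (intro conjI ballI K ext)
  fix X z assume "X \<in> endos"
  then show "\<sigma> X z = (K \<circ> X \<circ> inv K) z"
    using tw[of X "inv K z"] bij_is_surj[OF K(2)] by (simp add: surj_f_inv_f)
qed

lemma gives_intertwines: "gives K \<sigma> \<Longrightarrow> X \<in> endos \<Longrightarrow> K (X u) = \<sigma> X (K u)"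
  unfolding gives_def by (auto simp: bij_is_inj inv_f_f)

text \<open>The Skolem--Noether theorem for the endomorphism algebra of a vector space. For a vector
  \<open>y \<noteq> 0\<close> and a functional \<open>\<phi>\<close> with \<open>\<phi> y = 1\<close>, the maps
  \<open>R x = (\<lambda>u. \<phi> u *s x)\<close> form a left ideal isomorphic to \<open>V\<close>. Evaluating
  its image under \<open>\<sigma>\<close> at a suitable vector \<open>z\<close> gives a map
  \<open>K x = \<sigma> (R x) z\<close> intertwining the action of \<open>X\<close> with that of \<open>\<sigma> X\<close>,
  and simplicity of \<open>V\<close> makes \<open>K\<close> bijective.\<close>

lemma automorphism_inner:
  fixes y :: 'b
  assumes aut: "algebra_automorphism \<sigma>" and y: "y \<noteq> 0"
  shows "\<exists>K. gives K \<sigma>"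
proof -
  have lin: "linear_bijection \<sigma>"
    and comp: "\<And>X Y. X \<in> endos \<Longrightarrow> Y \<in> endos \<Longrightarrow> \<sigma> (X \<circ> Y) = \<sigma> X \<circ> \<sigma> Y"
    using aut by (auto simp: algebra_automorphism_def)
  have ex_functional: "\<exists>\<phi>. (\<forall>a b. \<phi> (a + b) = \<phi> a + \<phi> b) \<and> (\<forall>c a. \<phi> (c *s a) = c * \<phi> a) \<and> \<phi> x = 1"
    if "x \<noteq> 0" for x :: 'b
  proof -
    let ?B = "extend_basis {x}"
    have ind: "independent {x}" using that by simp
    have B: "independent ?B" "span ?B = UNIV" "x \<in> ?B"
      using independent_extend_basis[OF ind] span_extend_basis[OF ind]
        extend_basis_superset[OF ind] by auto
    show ?thesis
      using B representation_basis[of ?B x]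
      by (intro exI[of _ "\<lambda>u. representation ?B u x"])
        (auto simp: representation_add representation_scale)
  qed
  define R where "R \<phi> x = (\<lambda>u. \<phi> u *s x)" for \<phi> :: "'b \<Rightarrow> 'a" and x
  obtain \<phi> where \<phi>: "\<And>a b. \<phi> (a + b) = \<phi> a + \<phi> b" "\<And>c a. \<phi> (c *s a) = c * \<phi> a" "\<phi> y = 1"
    using ex_functional[OF y] by metis
  have R: "R \<phi> x \<in> endos" for x
    by (rule endosI) (simp_all add: R_def \<phi> scale_left_distrib)
  have "R \<phi> y \<noteq> (\<lambda>_. 0)"
    using y \<phi>(3) by (auto simp: R_def fun_eq_iff intro!: exI[of _ y])
  moreover have "inj_on \<sigma> endos"
    using lin by (simp add: linear_bijection_def bij_betw_def)
  ultimately have "\<sigma> (R \<phi> y) \<noteq> (\<lambda>_. 0)"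
    using linear_bijection_zero[OF lin] R endos_zero by (metis inj_onD)
  then obtain z where z: "\<sigma> (R \<phi> y) z \<noteq> 0" by (auto simp: fun_eq_iff)
  define K where "K x = \<sigma> (R \<phi> x) z" for x
  have "R \<phi> (a + b) = (\<lambda>u. R \<phi> a u + R \<phi> b u)" for a b
    by (simp add: R_def scale_right_distrib)
  moreover have "R \<phi> (c *s a) = (\<lambda>u. c *s R \<phi> a u)" for c a
    by (simp add: R_def mult.commute)
  ultimately have K: "K \<in> endos"
    by (intro endosI) (simp_all add: K_def linear_bijection_add linear_bijection_scale lin R)
  have tw: "K (X u) = \<sigma> X (K u)" if "X \<in> endos" for X u
  proof -
    have "R \<phi> (X u) = X \<circ> R \<phi> u" using that by (simp add: R_def endo_scale fun_eq_iff)
    then show ?thesis by (simp add: K_def comp that R)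
  qed
  have transitive: "\<exists>X\<in>endos. X a = b" if a: "a \<noteq> 0" for a b :: 'b
  proof -
    obtain \<psi> where \<psi>: "\<And>x y. \<psi> (x + y) = \<psi> x + \<psi> y" "\<And>c x. \<psi> (c *s x) = c * \<psi> x" "\<psi> a = 1"
      using ex_functional[OF a] by metis
    have "R \<psi> b \<in> endos"
      by (rule endosI) (simp_all add: R_def \<psi> scale_left_distrib)
    then show ?thesis using \<psi>(3) by (intro bexI[of _ "R \<psi> b"]) (simp_all add: R_def)
  qed
  have Ky: "K y \<noteq> 0" using z by (simp add: K_def)
  have "x = 0" if "K x = 0" for x
  proof (rule ccontr)
    assume "x \<noteq> 0"
    then obtain X where "X \<in> endos" "X x = y" using transitive by blast
    then have "K y = \<sigma> X 0" using tw[of X x] that by simp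
    with Ky \<open>X \<in> endos\<close> show False
      by (simp add: endo_zero linear_bijection_closed[OF lin])
  qed
  then have "inj K"
    by (intro injI) (metis K endo_diff right_minus_eq)
  moreover have "\<exists>a. b = K a" for b
  proof -
    obtain X where X: "X \<in> endos" "X (K y) = b" using transitive[OF Ky] by blast
    have "X \<in> \<sigma> ` endos"
      using lin X(1) by (simp add: linear_bijection_def bij_betw_def)
    then obtain Y where "Y \<in> endos" "\<sigma> Y = X" by blast
    then show ?thesis using tw[of Y y] X(2) by metis
  qed
  ultimately show ?thesis using givesI[OF K _ tw] by (auto simp: bij_def surj_def)
qed

section \<open>Polynomials in an endomorphism\<close>

lemma poly_endo_upto:
  assumes "degree p \<le> n"
  shows "poly_endo p X u = (\<Sum>k\<le>n. coeff p k *s (X ^^ k) u)"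
  unfolding poly_endo_def
  by (rule sum.mono_neutral_left) (use assms in \<open>auto simp: coeff_eq_0\<close>)

lemma poly_endo_pCons:
  assumes "X \<in> endos"
  shows "poly_endo (pCons a p) X u = a *s u + X (poly_endo p X u)"
proof -
  have "poly_endo (pCons a p) X u = (\<Sum>k\<le>Suc (degree p). coeff (pCons a p) k *s (X ^^ k) u)"
    by (rule poly_endo_upto) (simp add: degree_pCons_le)
  also have "\<dots> = a *s u + (\<Sum>k\<le>degree p. coeff p k *s X ((X ^^ k) u))"
    by (subst sum.atMost_Suc_shift) simp
  finally show ?thesis
    by (simp add: poly_endo_def endo_sum endo_scale assms)
qed

lemma poly_endo_0: "poly_endo 0 X u = 0"
  by (simp add: poly_endo_def)

lemma poly_endo_1: "poly_endo 1 X u = u"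
  by (simp add: poly_endo_def)

lemma poly_endo_commute: "X \<in> endos \<Longrightarrow> poly_endo p X (X u) = X (poly_endo p X u)"
  by (induction p) (simp_all add: poly_endo_0 poly_endo_pCons endo_simps)

lemma poly_endo_add: "poly_endo (p + q) X u = poly_endo p X u + poly_endo q X u"
proof -
  let ?n = "max (degree p) (degree q)"
  have "degree (p + q) \<le> ?n" by (rule degree_add_le_max)
  then show ?thesis
    by (simp add: poly_endo_upto[of _ ?n] scale_left_distrib sum.distrib)
qed

lemma poly_endo_smult: "poly_endo (smult c p) X u = c *s poly_endo p X u"
  using degree_smult_le[of c p]
  by (simp add: poly_endo_upto[of _ "degree p"] scale_sum_right)

lemma poly_endo_linear_factor:
  assumes "X \<in> endos"
  shows "poly_endo (p * [:- t, 1:]) X u = X (poly_endo p X u) - t *s poly_endo p X u"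
proof -
  have "p * [:- t, 1:] = smult (- t) p + pCons 0 p" by simp
  then show ?thesis
    by (simp only: poly_endo_add poly_endo_smult poly_endo_pCons[OF assms]) simp
qed

lemma poly_endo_eigenvector:
  assumes "X \<in> endos" "X u = t *s u"
  shows "poly_endo p X u = poly p t *s u"
  by (induction p)
    (simp_all add: poly_endo_0 poly_endo_pCons endo_simps assms scale_left_distrib mult.commute)

lemma tau_Suc: "tau A E (Suc i) = tau A E i * [:- eigenvalue_of A (E i), 1:]"
  by (simp add: tau_def tau_poly_def)

lemma eta_Suc: "eta d A E (Suc i) = eta d A E i * [:- eigenvalue_of A (E (d - i)), 1:]"
  by (simp add: eta_def eta_poly_def)

lemma tau_0: "tau A E 0 = 1" and eta_0: "eta d A E 0 = 1"
  by (simp_all add: tau_def tau_poly_def eta_def eta_poly_def)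

lemma tau_reverse: "tau A (\<lambda>i. E (d - i)) i = eta d A E i"
  by (simp add: tau_def tau_poly_def eta_def eta_poly_def)

lemma eta_reverse: "i \<le> d \<Longrightarrow> eta d A (\<lambda>i. E (d - i)) i = tau A E i"
  by (simp add: tau_def tau_poly_def eta_def eta_poly_def)

lemma degree_eta: "degree (eta d A E i) = i"
  by (simp add: eta_def eta_poly_def degree_prod_eq_sum_degree)

text \<open>Exchanging the two operators and reversing both orderings turns the formula for
  \<open>T\<close> into the formula for its image under the antiautomorphism. So what holds for
  \<open>T\<close> in every self-dual system holds for that image too.\<close>

lemma T_dagger_reverse:
  "T_dagger d A E As Es = T_elt d As (\<lambda>i. Es (d - i)) A (\<lambda>i. E (d - i))"
proof
  fix u
  show "T_dagger d A E As Es u = T_elt d As (\<lambda>i. Es (d - i)) A (\<lambda>i. E (d - i)) u"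
    unfolding T_dagger_def T_elt_def
    by (rule sum.reindex_bij_witness[of _ "\<lambda>i. d - i" "\<lambda>i. d - i"])
      (simp_all add: tau_reverse eta_reverse)
qed

end

section \<open>One operator seen in the eigenbasis of the other\<close>

text \<open>One half of a Leonard system: a basis of eigenvectors of \<open>A\<close>, with the
  projections \<open>E i\<close> onto its members, in which \<open>As\<close> is irreducible
  tridiagonal. A Leonard system provides two of these, with the roles of the operators
  exchanged.\<close>

locale tridiagonal_eigenbasis = endomorphism_algebra scale
  for scale :: "'a::field \<Rightarrow> 'b::ab_group_add \<Rightarrow> 'b"  (infixr "*s" 75) +
  fixes d :: nat and A As :: "'b \<Rightarrow> 'b" and E :: "nat \<Rightarrow> 'b \<Rightarrow> 'b"
    and v :: "nat \<Rightarrow> 'b" and M :: "nat \<Rightarrow> nat \<Rightarrow> 'a"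
  assumes A: "A \<in> endos" and As: "As \<in> endos"
    and E: "i \<le> d \<Longrightarrow> E i \<in> endos"
    and Av: "i \<le> d \<Longrightarrow> A (v i) = eigenvalue_of A (E i) *s v i"
    and Ev: "i \<le> d \<Longrightarrow> j \<le> d \<Longrightarrow> E i (v j) = (if i = j then v j else 0)"
    and eigenvalues_distinct: "inj_on (\<lambda>i. eigenvalue_of A (E i)) {..d}"
    and As_rep: "represents d v As M" and M: "irreducible_tridiagonal d M"
begin

abbreviation \<theta> where "\<theta> i \<equiv> eigenvalue_of A (E i)"

lemma basis: "ordered_basis d v"
  using As_rep by (simp add: represents_def)

lemma v_nonzero: "i \<le> d \<Longrightarrow> v i \<noteq> 0"
  using basis dependent_zero by (force simp: ordered_basis_def)

lemmas endo_eqI = ordered_basis_eqI[OF basis]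

lemma E_multiple:
  assumes "i \<le> d"
  obtains c where "E i u = c *s v i"
proof -
  have "u \<in> span (v ` {..d})" using basis by (simp add: ordered_basis_def)
  then have "\<exists>c. E i u = c *s v i"
  proof (induction rule: span_induct_alt)
    case base
    show ?case using assms by (intro exI[of _ 0]) (simp add: endo_zero E)
  next
    case (step c x y)
    then obtain j b where "j \<le> d" "x = v j" "E i y = b *s v i" by auto
    then show ?case using assms
      by (intro exI[of _ "(if i = j then c else 0) + b"])
        (simp add: endo_simps E Ev scale_left_distrib)
  qed
  then show thesis using that by blast
qed

lemma sum_E: "(\<Sum>i\<le>d. E i u) = u"
proof -
  have "(\<lambda>u. \<Sum>i\<le>d. E i u) = id"
    by (rule endo_eqI[OF endos_sum endos_id]) (simp_all add: E Ev)
  then show ?thesis by (metis id_apply)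
qed

lemma eq_zeroI: "(\<And>i. i \<le> d \<Longrightarrow> E i u = 0) \<Longrightarrow> u = 0"
  using sum_E[of u] by simp

lemma A_E: "i \<le> d \<Longrightarrow> A (E i u) = \<theta> i *s E i u"
  by (rule E_multiple[of i u]) (auto simp: endo_simps A Av mult.commute)

lemma E_E: "i \<le> d \<Longrightarrow> j \<le> d \<Longrightarrow> E i (E j u) = (if i = j then E j u else 0)"
  by (rule E_multiple[of j u]) (auto simp: endo_simps E Ev)

lemma E_A: "i \<le> d \<Longrightarrow> E i (A u) = \<theta> i *s E i u"
proof -
  assume i: "i \<le> d"
  have "E i \<circ> A = (\<lambda>u. \<theta> i *s E i u)"
    by (rule endo_eqI[OF endos_comp endos_scale]) (auto simp: E A i Av Ev endo_simps)
  then show ?thesis by (metis comp_apply)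
qed

lemma E_poly: "i \<le> d \<Longrightarrow> E i (poly_endo p A u) = poly p (\<theta> i) *s E i u"
  by (induction p)
    (simp_all add: poly_endo_0 poly_endo_pCons endo_simps A E E_A scale_left_distrib mult.commute)

lemma E_As_v: "i \<le> d \<Longrightarrow> j \<le> d \<Longrightarrow> E i (As (v j)) = M i j *s v i"
  using As_rep by (simp add: represents_def endo_simps E Ev if_distrib cong: if_cong)

lemma E_As: "i \<le> d \<Longrightarrow> E i (As u) = (\<Sum>j\<le>d. E i (As (E j u)))"
  by (subst sum_E[of u, symmetric]) (simp add: endo_sum As E)

lemma E_As_E_far:
  assumes "i \<le> d" "j \<le> d" "i > Suc j \<or> j > Suc i"
  shows "E i (As (E j u)) = 0"
proof -
  have "M i j = 0"
    using M assms unfolding irreducible_tridiagonal_def tridiagonal_def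
    by (metis Suc_lessD less_irrefl)
  then show ?thesis
    by (rule_tac E_multiple[of j u]) (use assms in \<open>auto simp: endo_simps As E E_As_v\<close>)
qed

lemma reverse: "tridiagonal_eigenbasis scale d A As (\<lambda>i. E (d - i)) (\<lambda>i. v (d - i)) (\<lambda>i j. M (d - i) (d - j))"
proof unfold_locales
  fix i j assume ij: "i \<le> d" "j \<le> d"
  have "d - i = d - j \<longleftrightarrow> i = j" using ij by linarith
  then show "E (d - i) (v (d - j)) = (if i = j then v (d - j) else 0)" by (simp add: Ev)
next
  show "inj_on (\<lambda>i. \<theta> (d - i)) {..d}"
    using eigenvalues_distinct by (auto simp: inj_on_def dest!: bspec[of _ _ "d - _"])
next
  have "v i \<in> (\<lambda>i. v (d - i)) ` {..d}" if "i \<le> d" for i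
    by (rule image_eqI[of _ _ "d - i"]) (use that in auto)
  then have img: "(\<lambda>i. v (d - i)) ` {..d} = v ` {..d}" by auto
  have "inj_on (\<lambda>i. v (d - i)) {..d}"
    using basis by (auto simp: ordered_basis_def inj_on_def dest!: bspec[of _ _ "d - _"])
  moreover have "As (v (d - j)) = (\<Sum>i\<le>d. M (d - i) (d - j) *s v (d - i))" for j
  proof -
    have "As (v (d - j)) = (\<Sum>i\<le>d. M i (d - j) *s v i)"
      using As_rep by (simp add: represents_def)
    also have "\<dots> = (\<Sum>i\<le>d. M (d - i) (d - j) *s v (d - i))"
      by (rule sum.reindex_bij_witness[of _ "\<lambda>i. d - i" "\<lambda>i. d - i"]) auto
    finally show ?thesis .
  qed
  ultimately show "represents d (\<lambda>i. v (d - i)) As (\<lambda>i j. M (d - i) (d - j))"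
    using basis by (simp add: represents_def ordered_basis_def img)
next
  have "M (d - Suc i) (d - i) \<noteq> 0 \<and> M (d - i) (d - Suc i) \<noteq> 0" if "i < d" for i
  proof -
    have "d - i = Suc (d - Suc i)" "d - Suc i < d" using that by auto
    then show ?thesis using M by (metis irreducible_tridiagonal_def)
  qed
  moreover have "i = j \<or> i = Suc j \<or> j = Suc i"
    if "i \<le> d" "j \<le> d" "M (d - i) (d - j) \<noteq> 0" for i j
  proof -
    have "d - i = d - j \<or> d - i = Suc (d - j) \<or> d - j = Suc (d - i)"
      using M that by (auto simp: irreducible_tridiagonal_def tridiagonal_def)
    then show ?thesis using that by arith
  qed
  ultimately show "irreducible_tridiagonal d (\<lambda>i j. M (d - i) (d - j))"
    by (auto simp: irreducible_tridiagonal_def tridiagonal_def)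
qed (simp_all add: A As E Av)

text \<open>The eigenvalue equation is a three-term recurrence for the components of an eigenvector
  of \<open>As\<close>. As the superdiagonal of \<open>M\<close> does not vanish, the component at \<open>0\<close>
  determines all the others.\<close>

lemma E0_eigenvector_zero:
  assumes u: "As u = t *s u" and u0: "E 0 u = 0"
  shows "u = 0"
proof (rule eq_zeroI)
  fix i assume "i \<le> d"
  then show "E i u = 0"
  proof (induction i rule: less_induct)
    case (less i)
    show ?case
    proof (cases i)
      case 0
      then show ?thesis using u0 by simp
    next
      case (Suc k)
      then have k: "k \<le> d" "k < i" using less.prems by auto
      have "E k (As u) = 0"
        using less.IH[of k] k by (simp add: u endo_simps E)
      moreover have "E k (As (E j u)) = 0" if "j \<le> d" "j \<noteq> i" for j
        using that less.IH[of j] E_As_E_far[of k j u] k Suc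
        by (cases j i rule: linorder_cases) (simp_all add: endo_zero As E)
      ultimately have "E k (As (E i u)) = 0"
        using E_As[of k u] k(1) less.prems sum.remove[of "{..d}" i "\<lambda>j. E k (As (E j u))"] by simp
      moreover obtain c where c: "E i u = c *s v i" using E_multiple less.prems by blast
      ultimately have "(c * M k i) *s v k = 0"
        using k less.prems by (simp add: endo_simps As E E_As_v)
      moreover have "M k i \<noteq> 0"
        using M Suc less.prems by (simp add: irreducible_tridiagonal_def)
      ultimately show ?thesis using v_nonzero[OF k(1)] c by simp
    qed
  qed
qed

lemma Ed_eigenvector_zero:
  assumes "As u = t *s u" "E d u = 0"
  shows "u = 0"
  using tridiagonal_eigenbasis.E0_eigenvector_zero[OF reverse] assms by simp

text \<open>Each application of the tridiagonal \<open>As\<close> moves the support of a vector up by at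
  most one place, so \<open>d\<close> applications are needed to get from place \<open>0\<close> to
  place \<open>d\<close>.\<close>

lemma Ed_poly_E0:
  assumes "degree p < d"
  shows "E d (poly_endo p As (E 0 u)) = 0"
proof -
  have "\<forall>j\<le>d. k < j \<longrightarrow> E j ((As ^^ k) (E 0 u)) = 0" for k
  proof (induction k)
    case 0
    show ?case by (simp add: E_E)
  next
    case (Suc k)
    show ?case
    proof (intro allI impI)
      fix j assume j: "j \<le> d" "Suc k < j"
      have "E j (As (E i ((As ^^ k) (E 0 u)))) = 0" if "i \<le> d" for i
        using Suc.IH that j E_As_E_far[of j i]
        by (cases "k < i") (simp_all add: endo_zero As E)
      then show "E j ((As ^^ Suc k) (E 0 u)) = 0"
        using E_As[OF j(1), of "(As ^^ k) (E 0 u)"] by simp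
    qed
  qed
  then show ?thesis
    using assms by (simp add: poly_endo_def endo_simps E)
qed

text \<open>By distinctness of the eigenvalues this factor is nonzero; it relates
  \<open>\<eta>\<close> of degree \<open>d\<close>, evaluated at \<open>A\<close>, to \<open>E 0\<close>.\<close>

definition eta_end :: 'a where "eta_end = poly (eta d A E d) (\<theta> 0)"

lemma eta_end_nonzero: "eta_end \<noteq> 0"
proof -
  have "\<theta> 0 \<noteq> \<theta> (d - h)" if "h < d" for h
    using inj_onD[OF eigenvalues_distinct, of 0 "d - h"] that by auto
  then show ?thesis
    by (auto simp: eta_end_def eta_def eta_poly_def poly_prod)
qed

text \<open>The roots of this polynomial are all eigenvalues but one, so up to a nonzero factor it
  gives the primitive idempotent at the end of the ordering.\<close>

lemma eta_d_A: "poly_endo (eta d A E d) A = (\<lambda>u. eta_end *s E 0 u)"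
proof (rule endo_eqI)
  show "poly_endo (eta d A E d) A \<in> endos" by (rule endos_poly[OF A])
  show "(\<lambda>u. eta_end *s E 0 u) \<in> endos" by (simp add: endos_scale E)
  fix i assume i: "i \<le> d"
  have "poly (eta d A E d) (\<theta> i) = 0" if "i \<noteq> 0"
    using that i by (auto simp: eta_def eta_poly_def poly_prod intro!: bexI[of _ "d - i"])
  then show "poly_endo (eta d A E d) A (v i) = eta_end *s E 0 (v i)"
    using i by (auto simp: poly_endo_eigenvector[OF A Av] Ev eta_end_def)
qed

lemma tau_d_A: "\<exists>c. c \<noteq> 0 \<and> (\<forall>u. poly_endo (tau A E d) A u = c *s E d u)"
  using tridiagonal_eigenbasis.eta_d_A[OF reverse] tridiagonal_eigenbasis.eta_end_nonzero[OF reverse]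
  by (auto simp: eta_reverse)

lemma A_eta:
  assumes "i \<le> d"
  shows "A (poly_endo (eta d A E (d - i)) A u) =
    (if i = 0 then 0 else poly_endo (eta d A E (d - (i - 1))) A u) + \<theta> i *s poly_endo (eta d A E (d - i)) A u"
proof (cases i)
  case 0
  then show ?thesis by (simp add: eta_d_A endo_scale A A_E mult.commute)
next
  case (Suc k)
  then have "d - k = Suc (d - i)" "d - (d - i) = i" using assms by auto
  then show ?thesis using Suc by (simp add: eta_Suc poly_endo_linear_factor A del: mult_pCons_right)
qed

lemma tau_A:
  assumes "i \<le> d"
  shows "poly_endo (tau A E i) A (A u) =
    (if i = d then 0 else poly_endo (tau A E (Suc i)) A u) + \<theta> i *s poly_endo (tau A E i) A u"
proof (cases "i = d")
  case True
  obtain c where "\<And>u. poly_endo (tau A E d) A u = c *s E d u" using tau_d_A by blast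
  then show ?thesis using True by (simp add: E_A mult.commute)
qed (simp add: tau_Suc poly_endo_linear_factor A poly_endo_commute del: mult_pCons_right)

text \<open>Up to a nonzero factor both idempotents are polynomials in \<open>A\<close>.\<close>

lemma antiautomorphism_fixes_ends:
  assumes dag: "algebra_antiautomorphism dag" "dag A = A"
  shows "dag (E 0) = E 0" "dag (E d) = E d"
proof -
  have fixed: "dag P = P" if c: "c \<noteq> 0" and p: "\<And>u. poly_endo p A u = c *s P u" for c p P
  proof -
    have "P = (\<lambda>u. poly_endo (smult (inverse c) p) A u)"
      using c by (auto simp: poly_endo_smult p)
    then show ?thesis using antiautomorphism_poly[OF dag(1) A dag(2)] by simp
  qed
  show "dag (E 0) = E 0" by (rule fixed[OF eta_end_nonzero, of "eta d A E d"]) (simp add: eta_d_A)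
  show "dag (E d) = E d" using fixed tau_d_A by blast
qed

end

section \<open>The element T of a self-dual Leonard system\<close>

locale dual_eigenbases = endomorphism_algebra scale +
    X: tridiagonal_eigenbasis scale d A As E v M + Y: tridiagonal_eigenbasis scale d As A Es w N
  for scale :: "'a::field \<Rightarrow> 'b::ab_group_add \<Rightarrow> 'b"  (infixr "*s" 75)
    and d A As E Es v w M N +
  fixes \<sigma> :: "('b \<Rightarrow> 'b) \<Rightarrow> ('b \<Rightarrow> 'b)"
  assumes dual: "duality d A E As Es \<sigma>"
begin

lemma aut: "algebra_automorphism \<sigma>"
  and \<sigma>_ops: "\<sigma> A = As" "\<sigma> As = A"
  and \<sigma>_E: "i \<le> d \<Longrightarrow> \<sigma> (E i) = Es i" and \<sigma>_Es: "i \<le> d \<Longrightarrow> \<sigma> (Es i) = E i"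
  using dual by (auto simp: duality_def)

lemma lin: "linear_bijection \<sigma>"
  and \<sigma>_comp: "P \<in> endos \<Longrightarrow> Q \<in> endos \<Longrightarrow> \<sigma> (P \<circ> Q) = \<sigma> P \<circ> \<sigma> Q"
  using aut by (auto simp: algebra_automorphism_def)

lemma swap: "dual_eigenbases scale d As A Es E w v N M \<sigma>"
proof unfold_locales
  show "duality d As Es A E \<sigma>" using dual by (auto simp: duality_def)
qed

text \<open>This is the system whose element \<open>T\<close> is the dagger version of the original
  one; \<open>\<sigma>\<close> is a duality for it because the conditions on \<open>\<sigma>\<close> are
  symmetric in the two operators and in the indices.\<close>

lemma swap_reverse:
  "dual_eigenbases scale d As A (\<lambda>i. Es (d - i)) (\<lambda>i. E (d - i)) (\<lambda>i. w (d - i)) (\<lambda>i. v (d - i))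
     (\<lambda>i j. N (d - i) (d - j)) (\<lambda>i j. M (d - i) (d - j)) \<sigma>"
proof -
  have "duality d As (\<lambda>i. Es (d - i)) A (\<lambda>i. E (d - i)) \<sigma>"
    using dual by (auto simp: duality_def)
  then show ?thesis
    using X.reverse Y.reverse
    by (simp add: dual_eigenbases_def dual_eigenbases_axioms_def endomorphism_algebra_axioms)
qed

text \<open>The equation \<open>A \<circ> E i = \<theta> i E i\<close> is carried by \<open>\<sigma>\<close> to the
  corresponding equation for \<open>As\<close> and \<open>Es i\<close>, with the same scalar.\<close>

lemma eigenvalues_eq:
  assumes i: "i \<le> d"
  shows "Y.\<theta> i = X.\<theta> i"
proof -
  have "A \<circ> E i = (\<lambda>u. X.\<theta> i *s E i u)" by (simp add: fun_eq_iff X.A_E i)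
  then have "\<sigma> (A \<circ> E i) = \<sigma> (\<lambda>u. X.\<theta> i *s E i u)" by simp
  then have "As \<circ> Es i = (\<lambda>u. X.\<theta> i *s Es i u)"
    by (simp add: \<sigma>_comp X.A X.E i \<sigma>_ops \<sigma>_E linear_bijection_scale[OF lin])
  then have "As (Es i (w i)) = X.\<theta> i *s Es i (w i)" by (metis comp_apply)
  then show ?thesis using i Y.v_nonzero[OF i] by (simp add: Y.Av Y.Ev)
qed

lemma tau_eq: "i \<le> d \<Longrightarrow> tau As Es i = tau A E i"
  unfolding tau_def tau_poly_def by (intro prod.cong) (auto simp: eigenvalues_eq)

lemma eta_eq: "i \<le> d \<Longrightarrow> eta d As Es i = eta d A E i"
  unfolding eta_def eta_poly_def by (intro prod.cong) (auto simp: eigenvalues_eq)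

abbreviation T where "T \<equiv> T_elt d A E As Es"
abbreviation Td where "Td \<equiv> T_dagger d A E As Es"

lemma T_endo: "T \<in> endos"
  unfolding T_elt_def by (intro endos_intros) (auto simp: X.A X.As X.E Y.E)

text \<open>The defining sum telescopes: multiplying by \<open>A\<close> on the left raises the degree
  of the factor \<open>\<eta>\<close>, multiplying by \<open>As\<close> on the right raises that of
  \<open>\<tau>\<close>, and both shift the summation index by one. The correction terms agree
  because self-duality equates the eigenvalues of \<open>A\<close> and \<open>As\<close>, and the
  boundary terms vanish by the Cayley--Hamilton theorem.\<close>

lemma A_T: "A (T u) = T (As u)"
proof -
  \<comment> \<open>The shifted indices pair a factor \<open>\<eta>\<close> with a factor \<open>\<tau>\<close> from different summands.\<close>
  define F where "F i j u = poly_endo (eta d A E (d - i)) A (Es 0 (E d (poly_endo (tau As Es j) As u)))"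
    for i j u
  have T: "T u = (\<Sum>i\<le>d. F i i u)" for u by (simp add: T_elt_def F_def)
  have "A (T u) = (\<Sum>i\<le>d. (if i = 0 then 0 else F (i - 1) i u)) + (\<Sum>i\<le>d. X.\<theta> i *s F i i u)"
    unfolding T sum.distrib[symmetric] endo_sum[OF X.A]
    by (rule sum.cong) (simp_all add: F_def X.A_eta)
  also have "(\<Sum>i\<le>d. (if i = 0 then 0 else F (i - 1) i u)) = (\<Sum>i<d. F i (Suc i) u)"
    by (subst sum.atMost_shift) simp
  also have "\<dots> = (\<Sum>i\<le>d. (if i = d then 0 else F i (Suc i) u))"
    by (simp flip: lessThan_Suc_atMost)
  also have "\<dots> + (\<Sum>i\<le>d. X.\<theta> i *s F i i u) = T (As u)"
    unfolding T sum.distrib[symmetric]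
  proof (rule sum.cong)
    fix i assume "i \<in> {..d}"
    then show "(if i = d then 0 else F i (Suc i) u) + X.\<theta> i *s F i i u = F i i (As u)"
      by (simp add: F_def Y.tau_A eigenvalues_eq endo_simps X.E Y.E endos_poly X.A)
  qed simp
  finally show ?thesis .
qed

text \<open>In the row belonging to \<open>Es d\<close> only the summand containing the full product
  \<open>\<eta>\<close> of degree \<open>d\<close> survives.\<close>

lemma T_corner: "Es d (T u) = X.eta_end *s Es d (E 0 (Es 0 (E d u)))"
proof -
  define F where
    "F i = Es d (poly_endo (eta d A E (d - i)) A (Es 0 (E d (poly_endo (tau As Es i) As u))))" for i
  have "Es d (T u) = (\<Sum>i\<le>d. F i)" by (simp add: T_elt_def F_def endo_sum Y.E)
  also have "\<dots> = F 0 + (\<Sum>i<d. F (Suc i))" by (rule sum.atMost_shift)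
  also have "(\<Sum>i<d. F (Suc i)) = 0"
    by (rule sum.neutral) (simp add: F_def Y.Ed_poly_E0 degree_eta)
  finally show ?thesis
    by (simp add: F_def X.eta_d_A tau_0 poly_endo_1 endo_scale Y.E)
qed

text \<open>The difference of \<open>T\<close> and a multiple of \<open>K\<close> sends eigenvectors of
  \<open>As\<close> to eigenvectors of \<open>A\<close>. An eigenvector of \<open>A\<close> vanishes as soon as
  its component in \<open>Es d\<close> does, so it is enough to compare \<open>Es d \<circ> T\<close> with
  \<open>Es d \<circ> K\<close>. Since \<open>Es d \<circ> K = K \<circ> E d\<close>, both factor through
  \<open>E d\<close> and have image in the line \<open>Es d V\<close>, so they are proportional.\<close>

lemma T_multiple:
  assumes K: "gives K \<sigma>"
  obtains \<kappa> where "\<kappa> \<noteq> 0" "T = (\<lambda>u. \<kappa> *s K u)"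
proof -
  have Ke: "K \<in> endos" and inj: "inj K"
    using K by (auto simp: gives_def bij_is_inj)
  note tw = gives_intertwines[OF K]
  have row: "Es d (K u) = K (E d u)" for u by (simp add: tw X.E \<sigma>_E)
  have v0: "v d \<noteq> 0" "v 0 \<noteq> 0" "w 0 \<noteq> 0" by (simp_all add: X.v_nonzero Y.v_nonzero)
  \<comment> \<open>Both maps factor through \<open>E d\<close>, so their ratio can be read off at \<open>v d\<close>.\<close>
  obtain e where e: "K (v d) = e *s w d"
    using Y.E_multiple[of d "K (v d)"] by (auto simp: row X.Ev)
  have e0: "e \<noteq> 0"
    using e v0(1) injD[OF inj, of "v d" 0] by (auto simp: endo_zero Ke)
  obtain b where b: "Es d (E 0 (Es 0 (v d))) = b *s w d"
    using Y.E_multiple[of d] by blast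
  have b0: "b \<noteq> 0"
  proof
    assume "b = 0"
    obtain p where p: "Es 0 (v d) = p *s w 0" using Y.E_multiple[of 0] by blast
    obtain q where q: "E 0 (w 0) = q *s v 0" using X.E_multiple[of 0] by blast
    have "p \<noteq> 0" using Y.E0_eigenvector_zero[OF X.Av, of d] v0 p by auto
    moreover have "q \<noteq> 0" using X.E0_eigenvector_zero[OF Y.Av, of 0] v0 q by auto
    moreover have "Es d (v 0) \<noteq> 0" using Y.Ed_eigenvector_zero[OF X.Av, of 0] v0 by auto
    ultimately show False
      using b \<open>b = 0\<close> by (simp add: p q endo_scale X.E Y.E)
  qed
  define \<kappa> where "\<kappa> = X.eta_end * b / e"
  have "\<kappa> \<noteq> 0" by (simp add: \<kappa>_def X.eta_end_nonzero b0 e0)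
  have corner: "Es d (T u) = Es d (\<kappa> *s K u)" for u
  proof -
    obtain a where a: "E d u = a *s v d" using X.E_multiple[of d] by blast
    then have "Es d (T u) = (X.eta_end * (a * b)) *s w d"
      by (simp add: T_corner b endo_scale X.E Y.E)
    moreover have "Es d (\<kappa> *s K u) = (\<kappa> * (a * e)) *s w d"
      by (simp add: endo_scale Y.E row a e Ke)
    ultimately show ?thesis by (simp add: \<kappa>_def e0)
  qed
  have "T = (\<lambda>u. \<kappa> *s K u)"
  proof (rule Y.endo_eqI[OF T_endo endos_scale[OF Ke]])
    fix i assume i: "i \<le> d"
    let ?z = "T (w i) - \<kappa> *s K (w i)"
    have "A (K (w i)) = K (As (w i))" by (simp add: tw X.As \<sigma>_ops)
    then have "A ?z = Y.\<theta> i *s ?z"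
      by (simp add: A_T Y.Av i endo_simps X.A T_endo Ke scale_right_diff_distrib mult.commute)
    moreover have "Es d ?z = 0"
      using corner[of "w i"] by (simp add: endo_diff Y.E)
    ultimately have "?z = 0" by (rule Y.Ed_eigenvector_zero)
    then show "T (w i) = \<kappa> *s K (w i)" by simp
  qed
  with \<open>\<kappa> \<noteq> 0\<close> show thesis by (rule that)
qed

lemma T_gives: "gives T \<sigma>"
proof -
  obtain K where K: "gives K \<sigma>"
    using automorphism_inner[OF aut, of "v 0"] X.v_nonzero by auto
  then have Ke: "K \<in> endos" "bij K" by (auto simp: gives_def)
  obtain \<kappa> where \<kappa>: "\<kappa> \<noteq> 0" and T: "T = (\<lambda>u. \<kappa> *s K u)" using T_multiple[OF K] .
  have "bij (\<lambda>x. \<kappa> *s x)"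
    using \<kappa> by (intro o_bij[of "\<lambda>x. inverse \<kappa> *s x"]) (auto simp: fun_eq_iff)
  from bij_comp[OF Ke(2) this] have "bij T" by (simp add: T comp_def)
  moreover have "T (P u) = \<sigma> P (T u)" if "P \<in> endos" for P u
    using that by (simp add: T gives_intertwines[OF K] endo_scale linear_bijection_closed[OF lin])
  ultimately show ?thesis by (intro givesI T_endo)
qed

lemma \<sigma>_T: "\<sigma> T = T_elt d As Es A E"
  unfolding T_elt_def
  by (simp add: linear_bijection_sum[OF lin] \<sigma>_comp endos_comp endos_poly X.A X.As X.E Y.E
      automorphism_poly[OF aut] \<sigma>_ops \<sigma>_E \<sigma>_Es tau_eq eta_eq del: o_apply)

lemma \<sigma>_Td: "\<sigma> Td = T_dagger d As Es A E"
  unfolding T_dagger_def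
  by (simp add: linear_bijection_sum[OF lin] \<sigma>_comp endos_comp endos_poly X.A X.As X.E Y.E
      automorphism_poly[OF aut] \<sigma>_ops \<sigma>_E \<sigma>_Es tau_eq eta_eq del: o_apply)

lemma antiautomorphism_T:
  assumes dag: "algebra_antiautomorphism dag" "dag A = A" "dag As = As"
  shows "dag T = Td"
proof -
  have lin: "linear_bijection dag"
    and comp: "\<And>P Q. P \<in> endos \<Longrightarrow> Q \<in> endos \<Longrightarrow> dag (P \<circ> Q) = dag Q \<circ> dag P"
    using dag(1) by (auto simp: algebra_antiautomorphism_def)
  show ?thesis
    unfolding T_elt_def T_dagger_def
    by (simp add: linear_bijection_sum[OF lin] comp endos_comp endos_poly X.A X.As X.E Y.E
        antiautomorphism_poly dag X.antiautomorphism_fixes_ends Y.antiautomorphism_fixes_ends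
        comp_assoc del: o_apply)
qed

text \<open>Both elements give the duality, so they are proportional. The factor is read off in the
  corner cut out by \<open>Es 0\<close>. There each sum has a single nonzero summand, and the two
  summands are products of the same elements of \<open>Es 0 End(V) Es 0\<close> in opposite orders.
  That algebra is one-dimensional, hence commutative.\<close>

lemma Td_eq_T: "Td = T"
proof -
  interpret R: dual_eigenbases scale d As A "\<lambda>i. Es (d - i)" "\<lambda>i. E (d - i)" "\<lambda>i. w (d - i)"
      "\<lambda>i. v (d - i)" "\<lambda>i j. N (d - i) (d - j)" "\<lambda>i j. M (d - i) (d - j)" \<sigma>
    by (rule swap_reverse)
  obtain \<kappa> where \<kappa>: "Td = (\<lambda>u. \<kappa> *s T u)"
    using R.T_multiple[OF T_gives] by (auto simp: T_dagger_reverse)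
  have v0: "v 0 \<noteq> 0" "v d \<noteq> 0" "w 0 \<noteq> 0" by (simp_all add: X.v_nonzero Y.v_nonzero)
  obtain m where m: "Es 0 (E 0 (w 0)) = m *s w 0" using Y.E_multiple[of 0] by blast
  obtain n where n: "Es 0 (E d (w 0)) = n *s w 0" using Y.E_multiple[of 0] by blast
  have "m \<noteq> 0"
    using X.E0_eigenvector_zero[OF Y.Av, of 0] Y.E0_eigenvector_zero[OF X.A_E, of 0 "w 0"] v0 m
    by auto
  moreover have "n \<noteq> 0"
    using X.Ed_eigenvector_zero[OF Y.Av, of 0] Y.E0_eigenvector_zero[OF X.A_E, of d "w 0"] v0 n
    by auto
  ultimately have nz: "(X.eta_end * (m * n)) *s w 0 \<noteq> 0" using v0 X.eta_end_nonzero by simp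
  have tau_pos: "poly (tau As Es (Suc i)) (Y.\<theta> 0) = 0" for i
    by (simp add: tau_def tau_poly_def poly_prod prod.lessThan_Suc_shift del: prod.lessThan_Suc)
  have "T (w 0) = poly_endo (eta d A E d) A (Es 0 (E d (w 0)))"
    unfolding T_elt_def
    by (subst sum.atMost_shift)
      (simp add: tau_0 poly_endo_1 poly_endo_eigenvector[OF Y.A Y.Av] tau_pos endo_zero X.E Y.E X.A endos_poly)
  then have 1: "Es 0 (T (w 0)) = (X.eta_end * (m * n)) *s w 0"
    by (simp add: n X.eta_d_A m endo_scale X.E Y.E endos_poly X.A mult.commute mult.left_commute)
  have "Es 0 (Td (w 0)) = Es 0 (E d (Es 0 (poly_endo (eta d A E d) A (w 0))))"
    unfolding T_dagger_def
    by (subst sum.atMost_shift)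
      (simp add: endo_simps Y.E tau_0 poly_endo_1 Y.E_poly tau_pos)
  then have 2: "Es 0 (Td (w 0)) = (X.eta_end * (m * n)) *s w 0"
    by (simp add: X.eta_d_A n m endo_scale X.E Y.E)
  have "\<kappa> *s ((X.eta_end * (m * n)) *s w 0) = (X.eta_end * (m * n)) *s w 0"
    using 1 2 by (simp add: \<kappa> endo_scale Y.E)
  then have "\<kappa> = 1" using nz by (metis scale_cancel_right scale_one)
  then show ?thesis by (simp add: \<kappa>)
qed

lemma \<sigma>_fixes_T: "\<sigma> T = T"
proof -
  have "\<sigma> T = T \<circ> T \<circ> inv T" "bij T" using T_gives T_endo by (auto simp: gives_def)
  then show ?thesis by (simp add: comp_assoc surj_iff bij_is_surj[unfolded surj_iff])
qed

lemma duality_conjugation: "duality d A E As Es (\<lambda>P. T \<circ> P \<circ> inv T)"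
proof -
  have eq: "T \<circ> P \<circ> inv T = \<sigma> P" if "P \<in> endos" for P
    using T_gives that by (simp add: gives_def)
  have "bij_betw (\<lambda>P. T \<circ> P \<circ> inv T) endos endos"
    using lin bij_betw_cong[of endos "\<lambda>P. T \<circ> P \<circ> inv T" \<sigma> endos] eq
    by (simp add: linear_bijection_def)
  moreover have "T \<circ> inv T = id"
    using T_gives by (simp add: gives_def bij_is_surj flip: surj_iff)
  ultimately show ?thesis
    using dual
    unfolding duality_def algebra_automorphism_def linear_bijection_def
    by (simp add: eq endos_add endos_scale endos_id endos_comp X.A X.As X.E Y.E del: o_apply)
qed

end

section \<open>Leonard systems\<close>

context endomorphism_algebra
begin

text \<open>Diagonalizability of \<open>A\<close> is what makes an element of
  \<open>primitive_idempotents A\<close> the projection onto an eigenspace: the definition prescribes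
  its values on eigenvectors only.\<close>

lemma standard_ordering_eigenbasis:
  assumes A: "A \<in> endos" and As: "As \<in> endos"
    and diag: "represents n u A D" "diagonal n D"
    and std: "standard_ordering d A As E"
  shows "\<exists>v M. tridiagonal_eigenbasis scale d A As E v M"
proof -
  have bij: "bij_betw E {..d} (primitive_idempotents A)"
    and choice: "\<And>v. (\<And>i. i \<le> d \<Longrightarrow> v i \<in> range (E i) \<and> v i \<noteq> 0) \<Longrightarrow>
          \<exists>M. represents d v As M \<and> irreducible_tridiagonal d M"
    using std by (auto simp: standard_ordering_def)
  have u: "ordered_basis n u" using diag(1) by (simp add: represents_def)
  have Au: "A (u j) = D j j *s u j" if "j \<le> n" for j
  proof -
    have "A (u j) = (\<Sum>i\<le>n. D i j *s u i)" using diag(1) that by (simp add: represents_def)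
    also have "\<dots> = (\<Sum>i\<le>n. if i = j then D j j *s u j else 0)"
      by (rule sum.cong) (use diag(2) that in \<open>auto simp: diagonal_def\<close>)
    finally show ?thesis using that by simp
  qed
  define t where "t i = eigenvalue_of A (E i)" for i
  have t: "primitive_idempotent_for A (t i) (E i)" if "i \<le> d" for i
  proof -
    have "E i \<in> primitive_idempotents A" using bij that by (auto simp: bij_betw_def)
    then obtain r where r: "primitive_idempotent_for A r (E i)"
      by (auto simp: primitive_idempotents_def)
    have "s = r" if s: "primitive_idempotent_for A s (E i)" for s
    proof (rule ccontr)
      assume "s \<noteq> r"
      obtain x where "x \<in> eigenspace A s" "x \<noteq> 0"
        using s by (auto simp: primitive_idempotent_for_def eigenvalue_def)
      with \<open>s \<noteq> r\<close> r s show False by (auto simp: primitive_idempotent_for_def)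
    qed
    with r have "t i = r"
      unfolding t_def eigenvalue_of_def by (intro the_equality)
    with r show ?thesis by simp
  qed
  have E: "E i \<in> endos" if "i \<le> d" for i
    using t[OF that] by (simp add: primitive_idempotent_for_def)
  have E_eigenvector: "E i x = (if s = t i then x else 0)" if "i \<le> d" "A x = s *s x" for i x s
    using t[OF that(1)] that(2) by (auto simp: primitive_idempotent_for_def eigenspace_def)
  have "A \<circ> E i = (\<lambda>x. t i *s E i x)" if i: "i \<le> d" for i
  proof (rule ordered_basis_eqI[OF u])
    show "A \<circ> E i \<in> endos" "(\<lambda>x. t i *s E i x) \<in> endos"
      using A E[OF i] by (simp_all add: endos_comp endos_scale del: o_apply)
    show "(A \<circ> E i) (u j) = t i *s E i (u j)" if "j \<le> n" for j
      using E_eigenvector[OF i Au[OF that]] Au[OF that] by (auto simp: endo_zero A)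
  qed
  then have AE: "A (E i x) = t i *s E i x" if "i \<le> d" for i x
    using that by (metis comp_apply)
  have inj: "inj_on t {..d}"
  proof (rule inj_onI)
    fix i j assume ij: "i \<in> {..d}" "j \<in> {..d}" "t i = t j"
    have "E i = E j"
      by (rule ordered_basis_eqI[OF u]) (use ij in \<open>simp_all add: E E_eigenvector[OF _ Au]\<close>)
    then show "i = j" using bij ij by (auto simp: bij_betw_def inj_on_def)
  qed
  have "\<exists>x. x \<in> range (E i) \<and> x \<noteq> 0" if "i \<le> d" for i
  proof -
    have ti: "primitive_idempotent_for A (t i) (E i)" using t that .
    then obtain x where "x \<in> eigenspace A (t i)" "x \<noteq> 0"
      by (auto simp: primitive_idempotent_for_def eigenvalue_def)
    moreover from this have "E i x = x"
      using ti by (simp add: primitive_idempotent_for_def)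
    ultimately show ?thesis by (metis rangeI)
  qed
  then obtain v where v: "\<And>i. i \<le> d \<Longrightarrow> v i \<in> range (E i) \<and> v i \<noteq> 0" by metis
  obtain M where M: "represents d v As M" "irreducible_tridiagonal d M" using choice[OF v] by blast
  have Av: "A (v i) = t i *s v i" if "i \<le> d" for i
    using v[OF that] AE[OF that] by auto
  have "tridiagonal_eigenbasis scale d A As E v M"
  proof unfold_locales
    fix i j assume ij: "i \<le> d" "j \<le> d"
    then show "E i (v j) = (if i = j then v j else 0)"
      using E_eigenvector[OF ij(1) Av[OF ij(2)]] inj by (auto simp: inj_on_def)
  qed (use A As E Av M inj in \<open>simp_all add: t_def inj_on_def\<close>)
  then show ?thesis by blast
qed

lemma leonard_system_eigenbases:
  assumes "leonard_system d A E As Es"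
  obtains v M w N where "tridiagonal_eigenbasis scale d A As E v M"
    and "tridiagonal_eigenbasis scale d As A Es w N"
proof -
  have pair: "leonard_pair A As" and std: "standard_ordering d A As E" "standard_ordering d As A Es"
    using assms by (auto simp: leonard_system_def)
  then have AAs: "A \<in> endos" "As \<in> endos" by (auto simp: leonard_pair_def)
  obtain n u D where 1: "represents n u A D" "diagonal n D"
    using pair unfolding leonard_pair_def by blast
  obtain m x F where 2: "represents m x As F" "diagonal m F"
    using pair unfolding leonard_pair_def by blast
  show thesis
    using that standard_ordering_eigenbasis[OF AAs 1 std(1)]
      standard_ordering_eigenbasis[OF AAs(2,1) 2 std(2)] by blast
qed

end

theorem theorem8p3:
  fixes scale :: "'a::field \<Rightarrow> 'b::ab_group_add \<Rightarrow> 'b"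
    and Basis :: "'b set"
    and d :: nat
    and A As T Ts Td Tsd :: "'b \<Rightarrow> 'b"
    and E Es :: "nat \<Rightarrow> 'b \<Rightarrow> 'b"
  assumes "finite_dimensional_vector_space scale Basis"
    and "0 < vector_space.dim scale (UNIV :: 'b set)"
    and "endomorphism_algebra.leonard_system scale d A E As Es"
    and "endomorphism_algebra.self_dual scale d A E As Es"
    and "T = endomorphism_algebra.T_elt scale d A E As Es"
    and "Ts = endomorphism_algebra.T_elt scale d As Es A E"
    and "Td = endomorphism_algebra.T_dagger scale d A E As Es"
    and "Tsd = endomorphism_algebra.T_dagger scale d As Es A E"
  shows "T = Ts \<and> T = Td \<and> T = Tsd \<and>
    (\<forall>dag. endomorphism_algebra.algebra_antiautomorphism scale dag \<and> dag A = A \<and> dag As = As \<longrightarrow>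
       dag T = Td \<and> dag Ts = Tsd) \<and>
    bij T \<and>
    endomorphism_algebra.duality scale d A E As Es (\<lambda>X. T \<circ> X \<circ> inv T) \<and>
    (\<forall>\<sigma>. endomorphism_algebra.duality scale d A E As Es \<sigma> \<longrightarrow>
       endomorphism_algebra.gives scale T \<sigma>)"
proof -
  interpret endomorphism_algebra scale
    using assms(1) by (simp add: endomorphism_algebra_def finite_dimensional_vector_space_def)
  obtain v M w N where frames: "tridiagonal_eigenbasis scale d A As E v M"
      "tridiagonal_eigenbasis scale d As A Es w N"
    using leonard_system_eigenbases[OF assms(3)] .
  have frame: "dual_eigenbases scale d A As E Es v w M N \<sigma>" if "duality d A E As Es \<sigma>" for \<sigma>
    using frames that
    by (simp add: dual_eigenbases_def dual_eigenbases_axioms_def endomorphism_algebra_axioms)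
  obtain \<sigma> where \<sigma>: "duality d A E As Es \<sigma>" using assms(4) by (auto simp: self_dual_def)
  interpret dual_eigenbases scale d A As E Es v w M N \<sigma> by (rule frame[OF \<sigma>])
  note T_defs = assms(5-8)
  have "Ts = T" "Td = T" using \<sigma>_T \<sigma>_fixes_T Td_eq_T by (simp_all add: T_defs)
  moreover have "Tsd = T" using \<sigma>_Td \<sigma>_fixes_T Td_eq_T by (simp add: T_defs)
  moreover have "dag T = Td \<and> dag Ts = Tsd"
    if "algebra_antiautomorphism dag" "dag A = A" "dag As = As" for dag
    using antiautomorphism_T[OF that] dual_eigenbases.antiautomorphism_T[OF swap that(1,3,2)]
    by (simp add: T_defs)
  moreover have "bij T" using T_gives by (simp add: T_defs gives_def)
  moreover have "gives T \<rho>" if "duality d A E As Es \<rho>" for \<rho>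
    using dual_eigenbases.T_gives[OF frame[OF that]] by (simp add: T_defs)
  ultimately show ?thesis
    using duality_conjugation by (simp add: T_defs)
qed

end
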